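(* Let $d\in\mathbb{N}$, let $(S,+)$ be a semigroup and let $p$ be an idempotent in $(\beta S,+)$. Then for every $C\in p^d$ there is a sequence $(a_i)_{i=0}^{\infty}$ in $S$ such that for all $(m_0,\dots,m_d)\in\mathbb{Z}^{d+1}$ with $0\le m_0<m_1<\dots<m_d$, \[\{(x_1,\dots,x_d):\ x_i\in\mathrm{FS}(a_{m_{i-1}},\dots,a_{m_i-1}),\ 1\le i\le d\}\subseteq C.\]
   Context: Semigroups are infinite (discrete) and not assumed commutative. $\beta S$ is the set of ultrafilters on $S$; the operation extends by $A\in p+q$ iff $\{s\in S: A-s\in q\}\in p$, where $A-s=\{t\in S: s+t\in A\}$; $p$ is idempotent if $p+p=p$. The $d$-th tensor $p^d$ is the ultrafilter on $S^d$ given by: $A\in p^d$ iff $\{s_1\in S:\{s_2\in S:\cdots\{s_d\in S:(s_1,\dots,s_d)\in A\}\in p\cdots\}\in p\}\in p$. For $m\le n$, $\mathrm{FS}(a_m,\dots,a_n)=\{a_{\alpha_1}+a_{\alpha_2}+\dots+a_{\alpha_k}: \{\alpha_1<\dots<\alpha_k\}\subseteq\{m,\dots,n\},\ k\ge1\}$ (summed in increasing order of index). *)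

theory Defs
  imports Main
begin

text \<open>Points of \<open>\<beta>S\<close> are ultrafilters in the library type \<^typ>\<open>'a filter\<close>;
  membership \<open>A \<in> p\<close> reads \<^prop>\<open>\<forall>\<^sub>F x in p. x \<in> A\<close>.\<close>

definition ultrafilter :: "'a filter \<Rightarrow> bool" where
  "ultrafilter p \<longleftrightarrow>
     p \<noteq> bot \<and> (\<forall>A. (\<forall>\<^sub>F x in p. x \<in> A) \<or> (\<forall>\<^sub>F x in p. x \<notin> A))"

definition beta_add :: "'a::semigroup_add filter \<Rightarrow> 'a filter \<Rightarrow> 'a filter" where
  "beta_add p q = Abs_filter (\<lambda>P. \<forall>\<^sub>F s in p. \<forall>\<^sub>F t in q. P (s + t))"

text \<open>Elements of \<open>S\<^sup>d\<close> are lists of length \<open>d\<close>, so \<open>p\<^sup>d\<close> is a filter on lists,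
  concentrated on those of length \<open>d\<close>; \<open>p\<^sup>0\<close> is principal at the empty tuple.\<close>

primrec tensor_power :: "nat \<Rightarrow> 'a filter \<Rightarrow> 'a list filter" where
  "tensor_power 0 p = principal {[]}"
| "tensor_power (Suc d) p =
     Abs_filter (\<lambda>P. \<forall>\<^sub>F s in p. \<forall>\<^sub>F xs in tensor_power d p. P (s # xs))"

text \<open>A semigroup need not have a zero, so \<^const>\<open>sum_list\<close> is not available;
  only values on nonempty lists are used.\<close>

fun semigroup_sum :: "'a::semigroup_add list \<Rightarrow> 'a" where
  "semigroup_sum [x] = x"
| "semigroup_sum (x # y # zs) = x + semigroup_sum (y # zs)"

definition FS :: "(nat \<Rightarrow> 'a::semigroup_add) \<Rightarrow> nat \<Rightarrow> nat \<Rightarrow> 'a set" where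
  "FS a m n = {semigroup_sum (map a \<alpha>) | \<alpha>. \<alpha> \<noteq> [] \<and> sorted_wrt (<) \<alpha> \<and> set \<alpha> \<subseteq> {m..n}}"


text \<open>The nested expressions above really are filters, and operations on ultrafilters
  yield ultrafilters.\<close>

lemma eventually_beta_add:
  "(\<forall>\<^sub>F x in beta_add p q. P x) \<longleftrightarrow> (\<forall>\<^sub>F s in p. \<forall>\<^sub>F t in q. P (s + t))"
  unfolding beta_add_def
proof (rule eventually_Abs_filter, rule is_filter.intro, goal_cases)
  case (2 P Q)
  then show ?case by eventually_elim (rule eventually_conj)
next
  case (3 P Q)
  show ?case
    using 3(2) by (rule eventually_mono) (erule eventually_mono, use 3(1) in blast)
qed simp

lemma mem_beta_add_iff:
  "(\<forall>\<^sub>F x in beta_add p q. x \<in> A) \<longleftrightarrow> (\<forall>\<^sub>F s in p. \<forall>\<^sub>F t in q. t \<in> {t. s + t \<in> A})"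
  by (simp add: eventually_beta_add)

lemma eventually_tensor_power_Suc:
  "(\<forall>\<^sub>F xs in tensor_power (Suc d) p. P xs) \<longleftrightarrow>
     (\<forall>\<^sub>F s in p. \<forall>\<^sub>F xs in tensor_power d p. P (s # xs))"
  unfolding tensor_power.simps
proof (rule eventually_Abs_filter, rule is_filter.intro, goal_cases)
  case (2 P Q)
  then show ?case by eventually_elim (rule eventually_conj)
next
  case (3 P Q)
  show ?case
    using 3(2) by (rule eventually_mono) (erule eventually_mono, use 3(1) in blast)
qed simp

lemma ultrafilter_eventually_not_iff:
  assumes "ultrafilter p"
  shows "(\<forall>\<^sub>F x in p. \<not> P x) \<longleftrightarrow> \<not> (\<forall>\<^sub>F x in p. P x)"
proof
  show "\<not> (\<forall>\<^sub>F x in p. P x)" if "\<forall>\<^sub>F x in p. \<not> P x"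
  proof
    assume "\<forall>\<^sub>F x in p. P x"
    with that have "\<forall>\<^sub>F x in p. False" by eventually_elim simp
    then show False using assms by (simp add: ultrafilter_def eventually_False)
  qed
  have "(\<forall>\<^sub>F x in p. x \<in> Collect P) \<or> (\<forall>\<^sub>F x in p. x \<notin> Collect P)"
    using assms unfolding ultrafilter_def by blast
  then show "\<forall>\<^sub>F x in p. \<not> P x" if "\<not> (\<forall>\<^sub>F x in p. P x)"
    using that by simp
qed

lemma ultrafilterI:
  assumes "\<And>P. (\<forall>\<^sub>F x in p. \<not> P x) \<longleftrightarrow> \<not> (\<forall>\<^sub>F x in p. P x)"
  shows "ultrafilter p"
  using assms[of "\<lambda>_. True"] assms unfolding ultrafilter_def
  by (auto simp: eventually_False)

lemma ultrafilter_beta_add: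
  assumes "ultrafilter p" "ultrafilter q"
  shows "ultrafilter (beta_add p q)"
  by (rule ultrafilterI)
    (simp add: eventually_beta_add ultrafilter_eventually_not_iff assms)

lemma ultrafilter_tensor_power:
  assumes "ultrafilter p"
  shows "ultrafilter (tensor_power d p)"
proof (induction d)
  case 0
  show ?case by (rule ultrafilterI) (simp add: eventually_principal)
next
  case (Suc d)
  show ?case
    by (rule ultrafilterI)
      (simp only: eventually_tensor_power_Suc ultrafilter_eventually_not_iff assms Suc)
qed

lemma tensor_power_length: "\<forall>\<^sub>F xs in tensor_power d p. length xs = d"
proof (induction d)
  case 0
  show ?case by (simp add: eventually_principal)
next
  case (Suc d)
  then show ?case by (simp only: eventually_tensor_power_Suc length_Cons) simp
qed

end

theory Submission
  imports Defs
begin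

text \<open>Call a tuple good if almost every continuation of it to length \<open>d\<close>, in the sense of the
  corresponding tensor power, lies in \<open>C\<close>. A good tuple stays good when almost any element is
  appended. By idempotence, if it also stays good when almost any element is added to its last
  entry, then both kinds of extension preserve this stronger property for almost every element.
  The sequence is chosen greedily: only finitely many tuples arise from \<open>a\<^sub>0, \<dots>, a\<^bsub>n-1\<^esub>\<close>, so some
  \<open>a\<^sub>n\<close> serves all of them.\<close>

text \<open>Treating the empty tuple as if its last entry were a neutral element avoids a case
  distinction throughout.\<close>

definition add_last :: "'a::semigroup_add list \<Rightarrow> 'a \<Rightarrow> 'a list" where
  "add_last xs t = (if xs = [] then [t] else butlast xs @ [last xs + t])"

lemma add_last_snoc [simp]: "add_last (xs @ [s]) t = xs @ [s + t]"
  by (simp add: add_last_def)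

lemma add_last_add_last: "add_last (add_last xs s) t = add_last xs (s + t)"
  by (simp add: add_last_def add.assoc)

text \<open>\<open>xs\<close> itself is included because an index may be skipped.\<close>

definition extensions :: "'a::semigroup_add \<Rightarrow> 'a list \<Rightarrow> 'a list set" where
  "extensions x xs = {xs, xs @ [x], add_last xs x}"

text \<open>These are the tuples of sums of \<open>a\<close> over nonempty sets of indices below
  \<open>n\<close>, each set lying entirely before the next.\<close>

primrec reachable :: "(nat \<Rightarrow> 'a::semigroup_add) \<Rightarrow> nat \<Rightarrow> 'a list set" where
  "reachable a 0 = {[]}"
| "reachable a (Suc n) = (\<Union>xs\<in>reachable a n. extensions (a n) xs)"

lemma reachable_mono:
  assumes "m \<le> n"
  shows "reachable a m \<subseteq> reachable a n"
  using assms by (rule lift_Suc_mono_le[rotated]) (auto simp: extensions_def)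

lemma Nil_in_reachable: "[] \<in> reachable a n"
  using reachable_mono[of 0 n a] by simp

lemma semigroup_sum_snoc:
  "xs \<noteq> [] \<Longrightarrow> semigroup_sum (xs @ [x]) = semigroup_sum xs + x"
  by (induction xs rule: semigroup_sum.induct) (simp_all add: add.assoc)

text \<open>The first index of \<open>\<alpha>\<close> creates the new entry and each later one is
  added to it; the indices in between are skipped by monotonicity.\<close>

lemma snoc_semigroup_sum_in_reachable:
  assumes "xs \<in> reachable a m"
    and "\<alpha> \<noteq> []" "sorted_wrt (<) \<alpha>" "set \<alpha> \<subseteq> {m..<n}"
  shows "xs @ [semigroup_sum (map a \<alpha>)] \<in> reachable a n"
  using assms(2-)
proof (induction \<alpha> arbitrary: n rule: rev_nonempty_induct)
  case (single i)
  then have "xs \<in> reachable a i"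
    using assms(1) reachable_mono[of m i a] by auto
  then have "xs @ [a i] \<in> reachable a (Suc i)"
    by (auto simp: extensions_def)
  then show ?case
    using single reachable_mono[of "Suc i" n a] by auto
next
  case (snoc i \<alpha>)
  then have "xs @ [semigroup_sum (map a \<alpha>)] \<in> reachable a i"
    by (intro snoc.IH) (auto simp: sorted_wrt_append)
  then have "add_last (xs @ [semigroup_sum (map a \<alpha>)]) (a i) \<in> reachable a (Suc i)"
    unfolding reachable.simps extensions_def by blast
  then show ?case
    using snoc.prems snoc.hyps reachable_mono[of "Suc i" n a]
    by (auto simp: semigroup_sum_snoc)
qed

lemma block_sums_in_reachable:
  assumes "\<forall>i\<in>{1..length xs}. m (i - 1) < m i"
    and "\<forall>i\<in>{1..length xs}. xs ! (i - 1) \<in> FS a (m (i - 1)) (m i - 1)"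
  shows "xs \<in> reachable a (m (length xs))"
  using assms
proof (induction xs rule: rev_induct)
  case Nil
  then show ?case by (simp add: Nil_in_reachable)
next
  case (snoc x xs)
  let ?k = "length xs"
  have "\<forall>i\<in>{1..?k}. xs ! (i - 1) \<in> FS a (m (i - 1)) (m i - 1)"
  proof
    fix i assume "i \<in> {1..?k}"
    then show "xs ! (i - 1) \<in> FS a (m (i - 1)) (m i - 1)"
      using snoc.prems(2)[rule_format, of i] by (auto simp: nth_append split: if_splits)
  qed
  with snoc have xs: "xs \<in> reachable a (m ?k)" by simp
  have lt: "m ?k < m (Suc ?k)"
    using snoc.prems(1)[rule_format, of "Suc ?k"] by simp
  have "x \<in> FS a (m ?k) (m (Suc ?k) - 1)"
    using snoc.prems(2)[rule_format, of "Suc ?k"] by simp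
  then obtain \<alpha> where \<alpha>: "x = semigroup_sum (map a \<alpha>)" "\<alpha> \<noteq> []" "sorted_wrt (<) \<alpha>"
    "set \<alpha> \<subseteq> {m ?k..m (Suc ?k) - 1}"
    unfolding FS_def by blast
  \<comment> \<open>Since \<open>lt\<close> makes \<open>m (Suc ?k)\<close> positive, the truncated
    subtraction of 1 does no harm.\<close>
  moreover from \<alpha>(4) lt have "set \<alpha> \<subseteq> {m ?k..<m (Suc ?k)}" by fastforce
  ultimately show ?case
    using snoc_semigroup_sum_in_reachable[OF xs] by simp
qed

text \<open>This is the Galvin-Glazer argument, with a property \<open>Q\<close> of tuples in place
  of a member of \<open>p\<close>.\<close>

lemma idempotent_reachable:
  fixes p :: "'a::semigroup_add filter"
  assumes "p \<noteq> bot" and idem: "beta_add p p = p"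
    and "Q []" and step: "\<And>xs. Q xs \<Longrightarrow> \<forall>\<^sub>F s in p. Q (xs @ [s])"
  shows "\<exists>a. \<forall>n. \<forall>xs\<in>reachable a n. Q xs"
proof -
  \<comment> \<open>\<open>G\<close> plays the role of the set of those \<open>s\<close> in A for
    which A - s belongs to \<open>p\<close>.\<close>
  define G where "G xs \<longleftrightarrow> Q xs \<and> (\<forall>\<^sub>F t in p. Q (add_last xs t))" for xs
  have split: "\<forall>\<^sub>F s in p. \<forall>\<^sub>F t in p. P (s + t)" if "\<forall>\<^sub>F x in p. P x" for P
    using that eventually_beta_add[of P p p] by (simp add: idem)
  \<comment> \<open>Here \<open>split\<close> yields \<open>Q (xs @ [s + t])\<close>, the second
    conjunct of \<open>G (xs @ [s])\<close>.\<close>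
  have G_append: "\<forall>\<^sub>F s in p. G (xs @ [s])" if "G xs" for xs
    using that step[of xs] split[of "\<lambda>s. Q (xs @ [s])"]
    by (simp add: G_def eventually_conj)
  have G_add_last: "\<forall>\<^sub>F s in p. G (add_last xs s)" if "G xs" for xs
    using that split[of "\<lambda>s. Q (add_last xs s)"]
    by (simp add: G_def add_last_add_last eventually_conj)
  have "\<exists>x. \<forall>xs\<in>T. \<forall>ys\<in>extensions x xs. G ys" if "finite T" "\<forall>xs\<in>T. G xs" for T
  proof -
    have "\<forall>\<^sub>F x in p. \<forall>ys\<in>extensions x xs. G ys" if "xs \<in> T" for xs
      using G_append[of xs] G_add_last[of xs] \<open>\<forall>xs\<in>T. G xs\<close> that
      by (simp add: extensions_def eventually_conj)
    then have "\<forall>\<^sub>F x in p. \<forall>xs\<in>T. \<forall>ys\<in>extensions x xs. G ys"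
      using \<open>finite T\<close> by (simp add: eventually_ball_finite_distrib)
    then show ?thesis
      using \<open>p \<noteq> bot\<close> eventually_happens' by blast
  qed
  then obtain f where f: "\<And>T xs ys. finite T \<Longrightarrow> \<forall>xs\<in>T. G xs \<Longrightarrow> xs \<in> T
      \<Longrightarrow> ys \<in> extensions (f T) xs \<Longrightarrow> G ys"
    by metis
  \<comment> \<open>\<open>T\<close> is built from \<open>f\<close> alone, so the recursion is not
    circular: \<open>a\<close> is read off from it, and only then is \<open>T n\<close> seen to be
    \<open>reachable a n\<close>.\<close>
  define T where "T = rec_nat {[]} (\<lambda>_ T. \<Union>xs\<in>T. extensions (f T) xs)"
  define a where "a n = f (T n)" for n
  have T: "reachable a n = T n" for n
    by (induction n) (simp_all add: T_def a_def)
  have "finite (T n) \<and> (\<forall>xs\<in>T n. G xs)" for n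
  proof (induction n)
    case 0
    have "\<forall>\<^sub>F t in p. Q [t]" using step[OF \<open>Q []\<close>] by simp
    then show ?case using \<open>Q []\<close> by (simp add: T_def G_def add_last_def)
  next
    case (Suc n)
    have "T (Suc n) = (\<Union>xs\<in>T n. extensions (f (T n)) xs)"
      by (simp add: T_def)
    with Suc show ?case
      using f[of "T n"] by (auto simp: extensions_def)
  qed
  then show ?thesis
    unfolding G_def T[symmetric] by blast
qed

theorem theorem4p1:
  fixes d :: nat
    and p :: "'a::semigroup_add filter"
    and C :: "'a list set"
  assumes "infinite (UNIV :: 'a set)"
    and "ultrafilter p"
    and "beta_add p p = p"
    and "C \<subseteq> {xs. length xs = d}"
    and "\<forall>\<^sub>F xs in tensor_power d p. xs \<in> C"
  shows "\<exists>a :: nat \<Rightarrow> 'a. \<forall>m :: nat \<Rightarrow> nat.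
           (\<forall>i\<in>{1..d}. m (i - 1) < m i) \<longrightarrow>
           {xs. length xs = d \<and> (\<forall>i\<in>{1..d}. xs ! (i - 1) \<in> FS a (m (i - 1)) (m i - 1))} \<subseteq> C"
proof -
  \<comment> \<open>Tuples longer than \<open>d\<close> count as good, so that goodness always passes to extensions.\<close>
  define good where "good xs \<longleftrightarrow> length xs \<le> d \<longrightarrow>
    (\<forall>\<^sub>F ys in tensor_power (d - length xs) p. xs @ ys \<in> C)" for xs
  have "\<forall>\<^sub>F s in p. good (xs @ [s])" if "good xs" for xs
  proof (cases "length xs < d")
    case True
    \<comment> \<open>This exposes the outermost quantifier of the tensor power, which ranges over
      the entry to be appended.\<close>
    then have "d - length xs = Suc (d - Suc (length xs))" by simp
    with that True
    have "\<forall>\<^sub>F ys in tensor_power (Suc (d - Suc (length xs))) p. xs @ ys \<in> C"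
      by (simp add: good_def del: tensor_power.simps)
    with True show ?thesis
      by (simp add: eventually_tensor_power_Suc good_def del: tensor_power.simps)
  qed (simp add: good_def)
  moreover have "p \<noteq> bot" "good []"
    using assms by (simp_all add: ultrafilter_def good_def)
  ultimately obtain a where a: "\<And>n xs. xs \<in> reachable a n \<Longrightarrow> good xs"
    using idempotent_reachable[of p good] assms(3) by blast
  \<comment> \<open>At full length the remaining power is principal at \<open>[]\<close>, so
    goodness is membership in \<open>C\<close>.\<close>
  have "xs \<in> C" if "good xs" "length xs = d" for xs
    using that by (simp add: good_def eventually_principal)
  with a block_sums_in_reachable[of _ _ a] show ?thesis
    by blast
qed

end
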